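(* Let $G$ be a group that admits a semigroup presentation $(S,R)$ (as a group), and let $\langle S\mid R\rangle^+$ be the monoid presented by $(S,R)$. Assume: (i) $R$ contains no relation $sv=sv'$ or $vs=v's$ with $s\in S$, $v,v'\in S^*$ and $v\neq v'$; (ii) there exists a map $\lambda:\langle S\mid R\rangle^+\to\mathbb{N}$ satisfying $\lambda(xy)\ge\lambda(x)+\lambda(y)$ for all $x,y\in\langle S\mid R\rangle^+$ and $\lambda(s)\ge1$ for (the class of) each $s\in S$; (iii) for all distinct $s,s'\in S$ there is at most one relation of the form $sv'=s'v$ (with $v,v'\in S^*$) in $R$, and for each $s\in S$ there is no relation of the form $sv'=sv$ in $R$; (iv) the left and the right cube conditions hold for each triple in $S^3$; (v) there exists a set $\widehat S\subseteq S^*$ that includes $S$ and is such that, for all $u,u'\in\widehat S$, there exist $v,v'\in\widehat S$ satisfying $u^{-1}u'\curvearrowright_R v'v^{-1}$. Then, for every word $\mathbf{w}$ in the alphabet $S\cup S^{-1}$, there exist unique words $v,v'\in S^*$ satisfying $\mathbf{w}\curvearrowright_R v'v^{-1}$, and $\mathbf{w}$ represents $1$ in $G$ if and only if $v^{-1}v'\curvearrowright_R\varepsilon$ holds for these words $v, v'$.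
   Context: A semigroup presentation $(S,R)$ consists of a nonempty set $S$ and a family $R$ of relations; a relation is an unordered pair $\{v,v'\}$ of nonempty words of $S^*$ (the free monoid on $S$; no inverses of generators occur), written $v=v'$. The presented monoid is $\langle S\mid R\rangle^+=S^*/{\equiv}$, where $\equiv$ is the least congruence on $S^*$ containing $R$. $\varepsilon$ denotes the empty word. A signed word is a word in the alphabet $S\cup S^{-1}$, where $S^{-1}$ is a disjoint formal copy of $S$. For $w=s_1\cdots s_p\in S^*$, $w^{-1}$ denotes the signed word $s_p^{-1}\cdots s_1^{-1}$. Right-reversing: a signed word $\mathbf{w}$ right-reverses in one step to $\mathbf{w}'$ if $\mathbf{w}'$ is obtained from $\mathbf{w}$ by replacing some subword $s^{-1}s'$ (with $s,s'\in S$) by $v'v^{-1}$, where $v,v'\in S^*$ and $sv'=s'v$ is a relation of $R$, or by deleting some subword $s^{-1}s$ (i.e. the trivial relations $s=s$ are implicitly included in $R$). The relation $\curvearrowright_R$ is the reflexive-transitive closure of one-step right-reversing. Left-reversing is the symmetric notion: one step consists of replacing some subword $s's^{-1}$ (with $s,s'\in S$) by $v^{-1}v'$, where $v,v'\in S^*$ and $vs'=v's$ is a relation of $R$, or deleting some subword $ss^{-1}$; a signed word left-reverses to another one if it can be transformed into it by finitely many such steps. Right cube condition for $(u,u',u'')$, where $u,u',u''\in S^*$: for all $v,v'\in S^*$, if $u^{-1}u''u''^{-1}u'\curvearrowright_R v'v^{-1}$, then $(uv')^{-1}(u'v)\curvearrowright_R\varepsilon$. Left cube condition for $(u,u',u'')$: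 for all $v,v'\in S^*$, if $uu''^{-1}u''u'^{-1}$ left-reverses to $v^{-1}v'$, then $(vu)(v'u')^{-1}$ left-reverses to $\varepsilon$. *)

theory Defs
  imports "HOL-Algebra.Group"
begin

section \<open>Presented monoids and groups\<close>

text \<open>The least congruence on the free monoid \<open>lists A\<close> containing the pairs of \<open>E\<close>.\<close>

inductive_set word_cong :: "'a set \<Rightarrow> ('a list \<times> 'a list) set \<Rightarrow> ('a list \<times> 'a list) set"
  for A :: "'a set" and E :: "('a list \<times> 'a list) set"
where
  base: "(u, v) \<in> E \<Longrightarrow> u \<in> lists A \<Longrightarrow> v \<in> lists A \<Longrightarrow> (u, v) \<in> word_cong A E"
| refl: "u \<in> lists A \<Longrightarrow> (u, u) \<in> word_cong A E"
| sym: "(u, v) \<in> word_cong A E \<Longrightarrow> (v, u) \<in> word_cong A E"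
| trans: "(u, v) \<in> word_cong A E \<Longrightarrow> (v, w) \<in> word_cong A E \<Longrightarrow> (u, w) \<in> word_cong A E"
| append: "(u, u') \<in> word_cong A E \<Longrightarrow> (v, v') \<in> word_cong A E \<Longrightarrow>
    (u @ v, u' @ v') \<in> word_cong A E"

definition word_quotient :: "'a set \<Rightarrow> ('a list \<times> 'a list) set \<Rightarrow> 'a list set monoid" where
  "word_quotient A E =
    \<lparr>carrier = lists A // word_cong A E,
     mult = (\<lambda>X Y. \<Union>u\<in>X. \<Union>v\<in>Y. word_cong A E `` {u @ v}),
     one = word_cong A E `` {[]}\<rparr>"

lemma word_cong_in_lists:
  assumes "(u, v) \<in> word_cong A E"
  shows "u \<in> lists A \<and> v \<in> lists A"
  using assms by induction auto

lemma equiv_word_cong: "equiv (lists A) (word_cong A E)"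
proof (rule equivI)
  show "word_cong A E \<subseteq> lists A \<times> lists A"
    by (rule subrelI) (simp add: word_cong_in_lists[THEN conjunct1] word_cong_in_lists[THEN conjunct2])
qed (auto intro!: refl_onI symI transI intro: word_cong.refl word_cong.sym word_cong.trans)

text \<open>The multiplication of \<^const>\<open>word_quotient\<close> is induced by concatenation.\<close>

lemma mult_word_quotient:
  assumes "u \<in> lists A" "v \<in> lists A"
  shows "word_cong A E `` {u} \<otimes>\<^bsub>word_quotient A E\<^esub> word_cong A E `` {v}
    = word_cong A E `` {u @ v}"
  using assms
  by (auto simp: word_quotient_def
      intro: word_cong.refl word_cong.append word_cong.trans word_cong.sym)

text \<open>A relation \<open>v = v'\<close> is the unordered pair \<open>{v, v'}\<close> of nonempty words.\<close>

definition semigroup_presentation :: "'a set \<Rightarrow> 'a list set set \<Rightarrow> bool" where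
  "semigroup_presentation S R \<longleftrightarrow> S \<noteq> {} \<and>
    (\<forall>r\<in>R. \<exists>v\<in>lists S. \<exists>v'\<in>lists S. v \<noteq> [] \<and> v' \<noteq> [] \<and> r = {v, v'})"

definition monoid_cong :: "'a set \<Rightarrow> 'a list set set \<Rightarrow> ('a list \<times> 'a list) set" where
  "monoid_cong S R = word_cong S {(v, v'). {v, v'} \<in> R}"

definition presented_monoid :: "'a set \<Rightarrow> 'a list set set \<Rightarrow> 'a list set monoid" where
  "presented_monoid S R = word_quotient S {(v, v'). {v, v'} \<in> R}"

datatype 'a signed = Pos 'a | Neg 'a

definition signed_alphabet :: "'a set \<Rightarrow> 'a signed set" where
  "signed_alphabet S = Pos ` S \<union> Neg ` S"

definition pos_word :: "'a list \<Rightarrow> 'a signed list" where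
  "pos_word w = map Pos w"

definition inv_word :: "'a list \<Rightarrow> 'a signed list" where
  "inv_word w = map Neg (rev w)"

text \<open>The group presented by \<open>(S, R)\<close> is the quotient of the free monoid on the signed alphabet
  by the congruence generated by \<open>R\<close> and the relations making \<open>Pos s\<close> and \<open>Neg s\<close> inverse.\<close>

definition group_relations :: "'a set \<Rightarrow> 'a list set set \<Rightarrow> ('a signed list \<times> 'a signed list) set"
  where
  "group_relations S R =
    {(pos_word v, pos_word v') | v v'. {v, v'} \<in> R}
    \<union> {([Pos s, Neg s], []) | s. s \<in> S} \<union> {([Neg s, Pos s], []) | s. s \<in> S}"

definition group_cong :: "'a set \<Rightarrow> 'a list set set \<Rightarrow> ('a signed list \<times> 'a signed list) set" where
  "group_cong S R = word_cong (signed_alphabet S) (group_relations S R)"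

definition presented_group :: "'a set \<Rightarrow> 'a list set set \<Rightarrow> 'a signed list set monoid" where
  "presented_group S R = word_quotient (signed_alphabet S) (group_relations S R)"

section \<open>Word reversing\<close>

inductive right_rev_step ::
  "'a set \<Rightarrow> 'a list set set \<Rightarrow> 'a signed list \<Rightarrow> 'a signed list \<Rightarrow> bool"
  for S :: "'a set" and R :: "'a list set set"
where
  relation: "s \<in> S \<Longrightarrow> s' \<in> S \<Longrightarrow> v \<in> lists S \<Longrightarrow> v' \<in> lists S \<Longrightarrow> {s # v', s' # v} \<in> R \<Longrightarrow>
    right_rev_step S R (x @ [Neg s, Pos s'] @ y) (x @ pos_word v' @ inv_word v @ y)"
| deletion: "s \<in> S \<Longrightarrow> right_rev_step S R (x @ [Neg s, Pos s] @ y) (x @ y)"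

definition right_reverses ::
  "'a set \<Rightarrow> 'a list set set \<Rightarrow> 'a signed list \<Rightarrow> 'a signed list \<Rightarrow> bool" where
  "right_reverses S R = (right_rev_step S R)\<^sup>*\<^sup>*"

inductive left_rev_step ::
  "'a set \<Rightarrow> 'a list set set \<Rightarrow> 'a signed list \<Rightarrow> 'a signed list \<Rightarrow> bool"
  for S :: "'a set" and R :: "'a list set set"
where
  relation: "s \<in> S \<Longrightarrow> s' \<in> S \<Longrightarrow> v \<in> lists S \<Longrightarrow> v' \<in> lists S \<Longrightarrow> {v @ [s'], v' @ [s]} \<in> R \<Longrightarrow>
    left_rev_step S R (x @ [Pos s', Neg s] @ y) (x @ inv_word v @ pos_word v' @ y)"
| deletion: "s \<in> S \<Longrightarrow> left_rev_step S R (x @ [Pos s, Neg s] @ y) (x @ y)"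

definition left_reverses ::
  "'a set \<Rightarrow> 'a list set set \<Rightarrow> 'a signed list \<Rightarrow> 'a signed list \<Rightarrow> bool" where
  "left_reverses S R = (left_rev_step S R)\<^sup>*\<^sup>*"

definition right_cube_condition ::
  "'a set \<Rightarrow> 'a list set set \<Rightarrow> 'a list \<Rightarrow> 'a list \<Rightarrow> 'a list \<Rightarrow> bool" where
  "right_cube_condition S R u u' u'' \<longleftrightarrow>
    (\<forall>v\<in>lists S. \<forall>v'\<in>lists S.
      right_reverses S R (inv_word u @ pos_word u'' @ inv_word u'' @ pos_word u')
        (pos_word v' @ inv_word v)
      \<longrightarrow> right_reverses S R (inv_word (u @ v') @ pos_word (u' @ v)) [])"

definition left_cube_condition ::
  "'a set \<Rightarrow> 'a list set set \<Rightarrow> 'a list \<Rightarrow> 'a list \<Rightarrow> 'a list \<Rightarrow> bool" where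
  "left_cube_condition S R u u' u'' \<longleftrightarrow>
    (\<forall>v\<in>lists S. \<forall>v'\<in>lists S.
      left_reverses S R (pos_word u @ inv_word u'' @ pos_word u'' @ inv_word u')
        (inv_word v @ pos_word v')
      \<longrightarrow> left_reverses S R (pos_word (v @ u) @ inv_word (v' @ u')) [])"

end

theory Submission
  imports Defs
begin

text \<open>
  The relation \<open>u\<inverse> v \<curvearrowright> \<epsilon>\<close> between positive words is reflexive, symmetric, compatible with
  concatenation and contains \<open>R\<close>. Induction on \<open>\<lambda>\<close> and the right cube condition on letters make it
  transitive, so it is the congruence \<open>\<equiv>\<close>; cancelling a letter on the left is then a matter of
  reversing \<open>s\<inverse> s\<close>. This does not use that the presentation is complemented, so it applies to the
  mirror image of \<open>R\<close> too, where the left cube condition gives right cancellation. By the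
  closed set of (v), reversing always terminates and right common multiples exist. Hence the words
  \<open>v' v\<inverse>\<close> compute in the Ore group of right fractions, in which \<open>v' v\<inverse> = 1\<close> only if \<open>v \<equiv> v'\<close>.
\<close>

section \<open>Reversing grids\<close>

text \<open>The trivial relations \<open>s = s\<close> are built in with both outputs empty, so that
  a deletion is a cell like any other. The arguments are ordered as in \<open>s\<inverse> s'\<close>
  reversing to \<open>v' v\<inverse>\<close>.\<close>

definition complement :: "'a set \<Rightarrow> 'a list set set \<Rightarrow> 'a \<Rightarrow> 'a \<Rightarrow> 'a list \<Rightarrow> 'a list \<Rightarrow> bool" where
  "complement S R s s' v' v \<longleftrightarrow> s \<in> S \<and> s' \<in> S \<and> v' \<in> lists S \<and> v \<in> lists S \<and>
    ({s # v', s' # v} \<in> R \<or> s = s' \<and> v' = [] \<and> v = [])"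

text \<open>A rectangular reversing diagram with left side \<open>u\<close>, top side
  \<open>u'\<close>, bottom side \<open>v'\<close> and right side \<open>v\<close>. Diagrams are
  generated by pasting, along the shared edge \<open>b\<close> in \<open>horizontal\<close> and
  \<open>a\<close> in \<open>vertical\<close>, so that no order of the reversing steps is singled
  out.\<close>

inductive grid :: "'a set \<Rightarrow> 'a list set set \<Rightarrow> 'a list \<Rightarrow> 'a list \<Rightarrow> 'a list \<Rightarrow> 'a list \<Rightarrow> bool"
  for S :: "'a set" and R :: "'a list set set"
where
  Nil_left: "u \<in> lists S \<Longrightarrow> grid S R [] u u []"
| Nil_right: "u \<in> lists S \<Longrightarrow> grid S R u [] [] u"
| cell: "complement S R s s' v' v \<Longrightarrow> grid S R [s] [s'] v' v"
| horizontal: "grid S R u u1 a b \<Longrightarrow> grid S R b u2 c d \<Longrightarrow> grid S R u (u1 @ u2) (a @ c) d"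
| vertical: "grid S R u1 u a b \<Longrightarrow> grid S R u2 a c d \<Longrightarrow> grid S R (u1 @ u2) u c (b @ d)"

lemma complement_sym: "complement S R s s' v' v \<Longrightarrow> complement S R s' s v v'"
  by (auto simp: complement_def insert_commute)

lemma grid_sym: "grid S R u u' v' v \<Longrightarrow> grid S R u' u v v'"
  by (induction rule: grid.induct) (auto intro: grid.intros complement_sym)

lemma grid_in_lists:
  "grid S R u u' v' v \<Longrightarrow> u \<in> lists S \<and> u' \<in> lists S \<and> v' \<in> lists S \<and> v \<in> lists S"
  by (induction rule: grid.induct) (auto simp: complement_def)

lemma grid_Nil_right_iff: "grid S R u [] a b \<longleftrightarrow> u \<in> lists S \<and> a = [] \<and> b = u"
proof -
  have "a = [] \<and> b = u" if "grid S R u w a b" "w = []" for w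
    using that by (induction rule: grid.induct) auto
  then show ?thesis
    using grid_in_lists[of S R u "[]" a b] by (auto intro: grid.Nil_right)
qed

lemma grid_Nil_left_iff: "grid S R [] u a b \<longleftrightarrow> u \<in> lists S \<and> a = u \<and> b = []"
  using grid_sym grid_Nil_right_iff by metis

text \<open>Whatever the order of pasting, a grid can be cut vertically at any point of its top
  side. For grids pasted side by side the cut falls into one of the two; for stacked grids it runs
  through both.\<close>

lemma grid_split_right:
  assumes "grid S R u (u1 @ u2) a d"
  shows "\<exists>a1 a2 b. a = a1 @ a2 \<and> grid S R u u1 a1 b \<and> grid S R b u2 a2 d"
proof -
  have "\<exists>a1 a2 b. a = a1 @ a2 \<and> grid S R u u1 a1 b \<and> grid S R b u2 a2 d"
    if "grid S R u w a d" "w = u1 @ u2" for w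
    using that
  proof (induction arbitrary: u1 u2 rule: grid.induct)
    case (Nil_left u)
    then show ?case
      by (auto simp: grid_Nil_left_iff)
  next
    case (Nil_right u)
    then show ?case
      by (auto simp: grid_Nil_right_iff)
  next
    case (cell s s' v' v)
    note cell' = grid.cell[OF cell.hyps]
    from cell.prems consider "u1 = []" "u2 = [s']" | "u1 = [s']" "u2 = []"
      by (auto simp: Cons_eq_append_conv)
    then show ?case
    proof cases
      case 1
      with cell' grid_in_lists[OF cell'] show ?thesis
        by (intro exI[of _ "[]"] exI[of _ v'] exI[of _ "[s]"]) (simp add: grid_Nil_right_iff)
    next
      case 2
      with cell' grid_in_lists[OF cell'] show ?thesis
        by (intro exI[of _ v'] exI[of _ "[]"] exI[of _ v]) (simp add: grid_Nil_right_iff)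
    qed
  next
    case (horizontal u w1 a b w2 c d)
    from horizontal.prems consider t where "w1 = u1 @ t" "t @ w2 = u2"
      | t where "w1 @ t = u1" "w2 = t @ u2"
      by (auto simp: append_eq_append_conv2)
    then show ?case
    proof cases
      case 1
      from horizontal.IH(1)[OF 1(1)] obtain a1 a2 e
        where *: "a = a1 @ a2" "grid S R u u1 a1 e" "grid S R e t a2 b"
        by blast
      have "grid S R e u2 (a2 @ c) d"
        using grid.horizontal[OF *(3) horizontal.hyps(2)] 1 by simp
      with * show ?thesis
        by (intro exI[of _ a1] exI[of _ "a2 @ c"] exI[of _ e]) simp
    next
      case 2
      from horizontal.IH(2)[OF 2(2)] obtain a1 a2 e
        where *: "c = a1 @ a2" "grid S R b t a1 e" "grid S R e u2 a2 d"
        by blast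
      have "grid S R u u1 (a @ a1) e"
        using grid.horizontal[OF horizontal.hyps(1) *(2)] 2 by simp
      with * show ?thesis
        by (intro exI[of _ "a @ a1"] exI[of _ a2] exI[of _ e]) simp
    qed
  next
    case (vertical w1 u a b w2 c d)
    from vertical.IH(1)[OF vertical.prems] obtain a1 a2 e where a: "a = a1 @ a2"
      and 1: "grid S R w1 u1 a1 e" "grid S R e u2 a2 b"
      by blast
    \<comment> \<open>The bottom side of the upper grid is the top side of the lower one, so the
      point where the cut leaves the former is where it enters the latter.\<close>
    from vertical.IH(2)[OF a] obtain c1 c2 f where "c = c1 @ c2"
      and 2: "grid S R w2 a1 c1 f" "grid S R f a2 c2 d"
      by blast
    with grid.vertical[OF 1(1) 2(1)] grid.vertical[OF 1(2) 2(2)] show ?case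
      by blast
  qed
  with assms show ?thesis by blast
qed

lemma grid_split_left:
  assumes "grid S R (u1 @ u2) u c d"
  shows "\<exists>d1 d2 a. d = d1 @ d2 \<and> grid S R u1 u a d1 \<and> grid S R u2 a c d2"
  using grid_split_right[OF grid_sym[OF assms]] grid_sym by blast

lemma grid_cell_iff: "grid S R [s] [s'] v' v \<longleftrightarrow> complement S R s s' v' v"
proof -
  have "complement S R s s' v' v" if "grid S R x y v' v" "x = [s]" "y = [s']" for x y
    using that
    by (induction rule: grid.induct)
      (auto simp: append_eq_Cons_conv grid_Nil_right_iff grid_Nil_left_iff)
  then show ?thesis
    by (auto intro: grid.cell)
qed

text \<open>A second grid with the same left and top sides can be cut along the lines where the
  first was pasted, which reduces uniqueness to single cells.\<close>

lemma grid_functional: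
  assumes complemented: "\<And>s s' a b c d. complement S R s s' a b \<Longrightarrow> complement S R s s' c d \<Longrightarrow>
      a = c \<and> b = d"
    and "grid S R u u' a b" "grid S R u u' c d"
  shows "a = c \<and> b = d"
  using assms(2,3)
proof (induction arbitrary: c d rule: grid.induct)
  case (cell s s' v' v)
  then show ?case
    using complemented by (auto simp: grid_cell_iff)
next
  case (horizontal u u1 a b u2 c d c' d')
  then show ?case
    using grid_split_right[OF horizontal.prems] by blast
next
  case (vertical u1 u a b u2 c d c' d')
  then show ?case
    using grid_split_left[OF vertical.prems] by blast
qed (auto simp: grid_Nil_right_iff grid_Nil_left_iff)

section \<open>Grids with empty bottom and right sides\<close>

lemma grid_refl: "u \<in> lists S \<Longrightarrow> grid S R u u [] []"
proof (induction u)
  case Nil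
  then show ?case
    by (simp add: grid_Nil_right_iff)
next
  case (Cons s u)
  then have "grid S R [s] [s] [] []"
    by (simp add: grid_cell_iff complement_def)
  then have "grid S R [s] ([s] @ u) ([] @ u) []"
    using Cons.prems by (intro grid.horizontal) (auto simp: grid_Nil_left_iff)
  with Cons have "grid S R ([s] @ u) ([s] @ u) [] ([] @ [])"
    by (intro grid.vertical) auto
  then show ?case by simp
qed

text \<open>Separating the first row and the first column leaves four pieces: the cell of the two
  first letters, the rest of the column with right side \<open>a\<close>, the rest of the row with
  bottom side \<open>b\<close>, and a grid on \<open>a\<close> and \<open>b\<close>. The inductions
  below remove first letters in this way.\<close>

lemma grid_Nil_Nil_Cons:
  "grid S R (s # t) (s' # t') [] [] \<longleftrightarrow>
    (\<exists>v' v a b. complement S R s s' v' v \<and> grid S R t v' [] a \<and> grid S R v t' b [] \<and>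
      grid S R a b [] [])" (is "?l = ?r")
proof
  assume ?l
  then obtain x where x: "grid S R [s] (s' # t') x []" "grid S R t x [] []"
    using grid_split_left[of S R "[s]" t "s' # t'" "[]" "[]"] by auto
  then obtain v' b v where "x = v' @ b" "grid S R [s] [s'] v' v" "grid S R v t' b []"
    using grid_split_right[of S R "[s]" "[s']" t' x "[]"] by auto
  moreover from this x obtain a where "grid S R t v' [] a" "grid S R a b [] []"
    using grid_split_right[of S R t v' b "[]" "[]"] by auto
  ultimately show ?r by (auto simp: grid_cell_iff)
next
  assume ?r
  then obtain v' v a b where "grid S R [s] [s'] v' v" "grid S R v t' b []"
    and t: "grid S R t v' [] a" "grid S R a b [] []"
    by (auto simp: grid_cell_iff)
  then have "grid S R [s] ([s'] @ t') (v' @ b) []"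
    by (blast intro: grid.horizontal)
  moreover from t have "grid S R t (v' @ b) [] []"
    using grid.horizontal by fastforce
  ultimately show ?l
    using grid.vertical by fastforce
qed

lemma grid_append_Nil_Nil:
  "grid S R t (v @ a) [] [] \<longleftrightarrow> (\<exists>b. grid S R t v [] b \<and> grid S R b a [] [])"
  using grid_split_right[of S R t v a "[]" "[]"] grid.horizontal[of S R t v "[]" _ a "[]" "[]"]
  by auto

lemma grid_append_right_Nil_Nil:
  assumes "grid S R u u' [] []" "w \<in> lists S"
  shows "grid S R (u @ w) (u' @ w) [] []"
proof -
  have "grid S R u (u' @ w) ([] @ w) []"
    using assms by (intro grid.horizontal) (auto simp: grid_Nil_left_iff)
  then show ?thesis
    using grid.vertical[of S R u "u' @ w" w "[]" w "[]" "[]"] grid_refl[OF assms(2)] by simp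
qed

lemma grid_append_left_Nil_Nil:
  assumes "grid S R u u' [] []" "w \<in> lists S"
  shows "grid S R (w @ u) (w @ u') [] []"
proof -
  have "grid S R w (w @ u') ([] @ u') []"
    using assms grid_in_lists[OF assms(1)] grid_refl[OF assms(2)]
    by (intro grid.horizontal) (auto simp: grid_Nil_left_iff)
  then show ?thesis
    using grid.vertical[of S R w "w @ u'" u' "[]" u "[]" "[]"] assms(1) by simp
qed

text \<open>Both words are factored into elements of \<open>S'\<close>, and the diagram is tiled by
  grids all of whose sides lie in \<open>S'\<close>. Closure provides each tile, and only finitely
  many are needed.\<close>

lemma grid_total:
  assumes S': "S' \<subseteq> lists S" "\<And>s. s \<in> S \<Longrightarrow> [s] \<in> S'"
    and closed: "\<And>u u'. u \<in> S' \<Longrightarrow> u' \<in> S' \<Longrightarrow> \<exists>v\<in>S'. \<exists>v'\<in>S'. grid S R u u' v' v"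
    and "u \<in> lists S" "u' \<in> lists S"
  shows "\<exists>v' v. grid S R u u' v' v"
proof -
  \<comment> \<open>One column of tiles: the bottom side of each tile is the top side of the next.
    The right side is again a product of elements of \<open>S'\<close>, so it can serve as the left
    side of another column.\<close>
  have column: "\<exists>vs\<in>lists S'. \<exists>v'\<in>S'. grid S R (concat us) u' v' (concat vs)"
    if "us \<in> lists S'" "u' \<in> S'" for us u'
    using that
  proof (induction us arbitrary: u')
    case Nil
    then show ?case
      using S'(1) by (auto simp: grid_Nil_left_iff intro!: bexI[of _ "[]"])
  next
    case (Cons u us)
    then obtain b a where 1: "b \<in> S'" "a \<in> S'" "grid S R u u' a b"
      using closed[of u u'] by auto
    with Cons obtain vs v' where "vs \<in> lists S'" "v' \<in> S'" "grid S R (concat us) a v' (concat vs)"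
      by (metis Cons_in_lists_iff)
    with 1 have "grid S R (concat (u # us)) u' v' (concat (b # vs))"
      by (auto intro: grid.vertical)
    with \<open>b \<in> S'\<close> \<open>vs \<in> lists S'\<close> \<open>v' \<in> S'\<close> show ?case
      by (meson lists.Cons)
  qed
  have "\<exists>vs\<in>lists S'. \<exists>v'. grid S R (concat us) (concat us') v' (concat vs)"
    if "us' \<in> lists S'" "us \<in> lists S'" for us us'
    using that
  proof (induction us' arbitrary: us)
    case Nil
    then have "concat us \<in> lists S"
      using S'(1) by (induction us) auto
    with Nil show ?case
      by (auto simp: grid_Nil_right_iff)
  next
    case (Cons u' us')
    then obtain vs v' where 1: "vs \<in> lists S'" "grid S R (concat us) u' v' (concat vs)"
      using column[of us u'] by auto
    moreover from this Cons obtain ws w'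
      where "ws \<in> lists S'" "grid S R (concat vs) (concat us') w' (concat ws)"
      by (metis Cons_in_lists_iff)
    ultimately show ?case
      by (auto intro: grid.horizontal)
  qed
  from this[of "map (\<lambda>s. [s]) u'" "map (\<lambda>s. [s]) u"] assms(4,5) S'(2)
  show ?thesis
    by (auto simp: in_lists_conv_set)
qed

section \<open>Reversing arbitrary signed words\<close>

text \<open>The signed word is read from left to right, and the state \<open>(p, q)\<close> stands for the already
  reversed prefix \<open>p q\<inverse>\<close>.\<close>

inductive run :: "'a set \<Rightarrow> 'a list set set \<Rightarrow> 'a list \<times> 'a list \<Rightarrow> 'a signed list \<Rightarrow>
    'a list \<times> 'a list \<Rightarrow> bool"
  for S :: "'a set" and R :: "'a list set set"
where
  Nil: "run S R x [] x"
| Neg: "s \<in> S \<Longrightarrow> run S R (p, s # q) w x \<Longrightarrow> run S R (p, q) (Neg s # w) x"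
| Pos: "grid S R q [s] a b \<Longrightarrow> run S R (p @ a, b) w x \<Longrightarrow> run S R (p, q) (Pos s # w) x"

inductive_simps run_Nil_iff: "run S R x [] y"
inductive_simps run_Neg_iff: "run S R (p, q) (Neg s # w) x"
inductive_simps run_Pos_iff: "run S R (p, q) (Pos s # w) x"

lemma run_append: "run S R x (u @ v) z \<longleftrightarrow> (\<exists>y. run S R x u y \<and> run S R y v z)"
proof (induction u arbitrary: x)
  case Nil
  then show ?case by (simp add: run_Nil_iff)
next
  case (Cons l u)
  then show ?case
    by (cases l; cases x) (auto simp: run_Neg_iff run_Pos_iff)
qed

lemma run_inv_word:
  "v \<in> lists S \<Longrightarrow> run S R (p, q) (inv_word v) x \<longleftrightarrow> x = (p, v @ q)"
  by (induction v arbitrary: x)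
    (auto simp: inv_word_def run_append run_Neg_iff run_Nil_iff)

lemma run_pos_word:
  assumes "q \<in> lists S"
  shows "run S R (p, q) (pos_word v) x \<longleftrightarrow> (\<exists>a b. grid S R q v a b \<and> x = (p @ a, b))"
  using assms
proof (induction v arbitrary: p q)
  case Nil
  then show ?case
    by (auto simp: pos_word_def run_Nil_iff grid_Nil_right_iff)
next
  case (Cons s v)
  have "run S R (p, q) (pos_word (s # v)) x \<longleftrightarrow>
      (\<exists>a b. grid S R q [s] a b \<and> run S R (p @ a, b) (pos_word v) x)"
    by (simp add: pos_word_def run_Pos_iff)
  also have "\<dots> \<longleftrightarrow> (\<exists>a b. grid S R q [s] a b \<and> (\<exists>c d. grid S R b v c d \<and> x = (p @ a @ c, d)))"
    using Cons.IH grid_in_lists[of S R q "[s]"] by (simp cong: conj_cong)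
  also have "\<dots> \<longleftrightarrow> (\<exists>a b. grid S R q (s # v) a b \<and> x = (p @ a, b))"
    using grid_split_right[of S R q "[s]" v] grid.horizontal[of S R q "[s]" _ _ v] by fastforce
  finally show ?case .
qed

section \<open>Independence of the order of the reversing steps\<close>

lemma run_in_lists:
  "run S R x w y \<Longrightarrow> fst x \<in> lists S \<Longrightarrow> snd x \<in> lists S \<Longrightarrow> fst y \<in> lists S \<and> snd y \<in> lists S"
  by (induction rule: run.induct) (auto dest: grid_in_lists)

text \<open>Runs are pulled back along a reversing step at an arbitrary position. This is what
  reduces arbitrary reversing sequences to reading from left to right.\<close>

lemma run_right_rev_step:
  assumes "right_rev_step S R w w'" "run S R (p, q) w' x" "p \<in> lists S" "q \<in> lists S"
  shows "run S R (p, q) w x"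
  using assms(1)
proof cases
  case (relation s s' v v' y z)
  then obtain p1 q1 where 1: "run S R (p, q) y (p1, q1)"
    and 2: "run S R (p1, q1) (pos_word v' @ inv_word v @ z) x"
    using assms(2) run_append[of S R "(p, q)" y] by (metis surj_pair)
  then have q1: "q1 \<in> lists S"
    using run_in_lists assms by fastforce
  with 2 relation obtain a b where 3: "grid S R q1 v' a b" "run S R (p1 @ a, v @ b) z x"
    by (auto simp: run_append run_pos_word run_inv_word)
  have "grid S R [s] [s'] v' v"
    using relation by (auto simp: grid_cell_iff complement_def)
  \<comment> \<open>Reading \<open>s\<inverse>\<close> puts \<open>s\<close> on top of
    \<open>q1\<close>. Stacking the cell of the step on the grid of \<open>q1\<close> and
    \<open>v'\<close> shows that reading \<open>s'\<close> next leads to the same state as reading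
    \<open>v' v\<inverse>\<close> directly.\<close>
  from grid.vertical[OF this 3(1)] have "grid S R (s # q1) [s'] a (v @ b)"
    by simp
  with 3 relation have "run S R (p1, q1) ([Neg s, Pos s'] @ z) x"
    by (auto simp: run_Neg_iff run_Pos_iff)
  with 1 relation show ?thesis
    by (auto simp: run_append)
next
  case (deletion s y z)
  then obtain p1 q1 where 1: "run S R (p, q) y (p1, q1)" "run S R (p1, q1) z x"
    using assms by (auto simp: run_append)
  then have "q1 \<in> lists S"
    using run_in_lists assms by fastforce
  with deletion have "grid S R ([s] @ q1) [s] [] ([] @ q1)"
    by (intro grid.vertical[OF grid_refl grid.Nil_right]) auto
  with 1 deletion have "run S R (p1, q1) ([Neg s, Pos s] @ z) x"
    by (force simp: run_Neg_iff run_Pos_iff)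
  with 1 deletion show ?thesis
    by (auto simp: run_append)
qed

lemma right_rev_step_context:
  "right_rev_step S R w w' \<Longrightarrow> right_rev_step S R (x @ w @ y) (x @ w' @ y)"
proof (induction rule: right_rev_step.induct)
  case (relation s s' v v' x' y')
  from right_rev_step.relation[OF this, of "x @ x'" "y' @ y"] show ?case by simp
next
  case (deletion s x' y')
  from right_rev_step.deletion[OF this, of R "x @ x'" "y' @ y"] show ?case by simp
qed

lemma right_reverses_context:
  "right_reverses S R w w' \<Longrightarrow> right_reverses S R (x @ w @ y) (x @ w' @ y)"
  unfolding right_reverses_def
  by (induction rule: rtranclp_induct) (auto intro: right_rev_step_context rtranclp.rtrancl_into_rtrancl)

lemma right_reverses_trans [trans]:
  "right_reverses S R u v \<Longrightarrow> right_reverses S R v w \<Longrightarrow> right_reverses S R u w"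
  unfolding right_reverses_def by (rule rtranclp_trans)

lemma inv_word_simps [simp]:
  "inv_word [] = []"
  "inv_word (u @ v) = inv_word v @ inv_word u"
  "inv_word (s # v) = inv_word v @ [Neg s]"
  by (simp_all add: inv_word_def)

lemma pos_word_simps [simp]:
  "pos_word [] = []"
  "pos_word (u @ v) = pos_word u @ pos_word v"
  "pos_word (s # v) = Pos s # pos_word v"
  by (simp_all add: pos_word_def)

lemma grid_imp_right_reverses:
  "grid S R u u' v' v \<Longrightarrow>
    right_reverses S R (inv_word u @ pos_word u') (pos_word v' @ inv_word v)"
proof (induction rule: grid.induct)
  case (cell s s' v' v)
  then consider "s \<in> S" "s' \<in> S" "v \<in> lists S" "v' \<in> lists S" "{s # v', s' # v} \<in> R"
    | "s \<in> S" "s = s'" "v' = []" "v = []"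
    by (auto simp: complement_def)
  then show ?case
  proof cases
    case 1
    from right_rev_step.relation[OF this, of "[]" "[]"] show ?thesis
      by (simp add: right_reverses_def r_into_rtranclp)
  next
    case 2
    with right_rev_step.deletion[of s S R "[]" "[]"] show ?thesis
      by (simp add: right_reverses_def r_into_rtranclp)
  qed
next
  case (horizontal u u1 a b u2 c d)
  have "right_reverses S R (inv_word u @ pos_word (u1 @ u2)) (pos_word a @ inv_word b @ pos_word u2)"
    using right_reverses_context[OF horizontal.IH(1), of "[]" "pos_word u2"] by simp
  also have "right_reverses S R \<dots> (pos_word (a @ c) @ inv_word d)"
    using right_reverses_context[OF horizontal.IH(2), of "pos_word a" "[]"] by simp
  finally show ?case .
next
  case (vertical u1 u a b u2 c d)
  have "right_reverses S R (inv_word (u1 @ u2) @ pos_word u) (inv_word u2 @ pos_word a @ inv_word b)"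
    using right_reverses_context[OF vertical.IH(1), of "inv_word u2" "[]"] by simp
  also have "right_reverses S R \<dots> (pos_word c @ inv_word (b @ d))"
    using right_reverses_context[OF vertical.IH(2), of "[]" "inv_word b"] by simp
  finally show ?case .
qed (simp_all add: right_reverses_def)

lemma run_imp_right_reverses:
  "run S R x w y \<Longrightarrow>
    right_reverses S R (pos_word (fst x) @ inv_word (snd x) @ w) (pos_word (fst y) @ inv_word (snd y))"
proof (induction rule: run.induct)
  case (Pos q s a b p w x)
  have "right_reverses S R (pos_word p @ inv_word q @ Pos s # w) (pos_word (p @ a) @ inv_word b @ w)"
    using right_reverses_context[OF grid_imp_right_reverses[OF Pos.hyps(1)], of "pos_word p" w]
    by simp
  with Pos.IH show ?case
    by (auto intro: right_reverses_trans)
qed (simp_all add: right_reverses_def)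

text \<open>From left to right, go backwards along the reversing sequence: the final word is read
  without any reversing, and each step pulls the run back. Conversely, each move of a run is itself
  a reversing.\<close>

lemma right_reverses_iff_run:
  assumes "v' \<in> lists S" "v \<in> lists S"
  shows "right_reverses S R w (pos_word v' @ inv_word v) \<longleftrightarrow> run S R ([], []) w (v', v)"
proof
  assume "right_reverses S R w (pos_word v' @ inv_word v)"
  then show "run S R ([], []) w (v', v)"
    unfolding right_reverses_def
  proof (induction rule: converse_rtranclp_induct)
    case base
    from assms show ?case
      by (simp add: run_append run_pos_word run_inv_word grid_Nil_left_iff)
  next
    case (step w w')
    then show ?case
      by (auto intro: run_right_rev_step)
  qed
next
  assume "run S R ([], []) w (v', v)"
  from run_imp_right_reverses[OF this] show "right_reverses S R w (pos_word v' @ inv_word v)"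
    by simp
qed

lemma right_reverses_iff_grid:
  assumes "u \<in> lists S" "v' \<in> lists S" "v \<in> lists S"
  shows "right_reverses S R (inv_word u @ pos_word u') (pos_word v' @ inv_word v) \<longleftrightarrow>
    grid S R u u' v' v"
  using assms by (simp add: right_reverses_iff_run run_append run_inv_word run_pos_word)

lemma right_reverses_Nil_iff_grid:
  "u \<in> lists S \<Longrightarrow> right_reverses S R (inv_word u @ pos_word u') [] \<longleftrightarrow> grid S R u u' [] []"
  using right_reverses_iff_grid[of u S "[]" "[]" R u'] by simp

lemma run_total:
  assumes "\<And>u u'. u \<in> lists S \<Longrightarrow> u' \<in> lists S \<Longrightarrow> \<exists>v' v. grid S R u u' v' v"
    and "w \<in> lists (signed_alphabet S)" "q \<in> lists S"
  shows "\<exists>x. run S R (p, q) w x"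
  using assms(2,3)
proof (induction w arbitrary: p q rule: list.induct)
  case Nil
  then show ?case by (auto simp: run_Nil_iff)
next
  case (Cons l w)
  then have w: "w \<in> lists (signed_alphabet S)" by simp
  show ?case
  proof (cases l)
    case (Pos s)
    with Cons.prems have "Pos s \<in> signed_alphabet S"
      by simp
    then have "s \<in> S"
      by (auto simp: signed_alphabet_def)
    then obtain a b where 1: "grid S R q [s] a b"
      using assms(1)[of q "[s]"] Cons.prems by auto
    then have "b \<in> lists S" by (auto dest: grid_in_lists)
    from Cons.IH[OF w this] obtain x where "run S R (p @ a, b) w x" by blast
    with run.Pos[OF 1] Pos show ?thesis
      by blast
  next
    case (Neg s)
    with Cons.prems have "Neg s \<in> signed_alphabet S"
      by simp
    then have "s \<in> S"
      by (auto simp: signed_alphabet_def)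
    with Cons Neg show ?thesis
      by (auto simp: run_Neg_iff)
  qed
qed

lemma run_functional:
  assumes complemented: "\<And>s s' a b c d. complement S R s s' a b \<Longrightarrow> complement S R s s' c d \<Longrightarrow>
      a = c \<and> b = d"
    and "run S R x w y" "run S R x w z"
  shows "y = z"
  using assms(2,3)
proof (induction arbitrary: z rule: run.induct)
  case (Pos q s a b p w x)
  from Pos.prems obtain a' b' where 1: "grid S R q [s] a' b'" "run S R (p @ a', b') w z"
    by (auto simp: run_Pos_iff)
  have "a = a' \<and> b = b'"
    by (rule grid_functional[OF complemented Pos.hyps(1) 1(1)])
  with Pos.IH 1 show ?case by simp
qed (auto simp: run_Nil_iff run_Neg_iff)

section \<open>The cube condition and completeness\<close>

text \<open>The three grids are three faces of the cube. Together they reverse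
  \<open>s\<inverse> s'' s''\<inverse> s'\<close> to \<open>(v' y') (w y)\<inverse>\<close>, which
  is the premise of the cube condition.\<close>

lemma right_cube_condition_grid:
  assumes "right_cube_condition S R [s] [s'] [s'']"
    and "complement S R s s'' v' v" "complement S R s'' s' w' w" "grid S R v w' y' y"
  shows "grid S R (s # v' @ y') (s' # w @ y) [] []"
proof -
  have in_lists: "s \<in> S" "s' \<in> S" "v' \<in> lists S" "w \<in> lists S" "y' \<in> lists S" "y \<in> lists S"
    using assms grid_in_lists[OF assms(4)] by (auto simp: complement_def)
  have 1: "right_reverses S R (inv_word [s] @ pos_word [s'']) (pos_word v' @ inv_word v)"
    and 2: "right_reverses S R (inv_word [s''] @ pos_word [s']) (pos_word w' @ inv_word w)"
    using assms by (auto simp: grid_cell_iff intro!: grid_imp_right_reverses simp del: inv_word_simps pos_word_simps)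
  note 3 = grid_imp_right_reverses[OF assms(4)]
  have "right_reverses S R (inv_word [s] @ pos_word [s''] @ inv_word [s''] @ pos_word [s'])
      (pos_word v' @ inv_word v @ inv_word [s''] @ pos_word [s'])"
    using right_reverses_context[OF 1, of "[]" "inv_word [s''] @ pos_word [s']"] by simp
  also have "right_reverses S R \<dots> (pos_word v' @ inv_word v @ pos_word w' @ inv_word w)"
    using right_reverses_context[OF 2, of "pos_word v' @ inv_word v" "[]"] by simp
  also have "right_reverses S R \<dots> (pos_word (v' @ y') @ inv_word (w @ y))"
    using right_reverses_context[OF 3, of "pos_word v'" "inv_word w"] by simp
  finally have "right_reverses S R (inv_word ([s] @ v' @ y') @ pos_word ([s'] @ w @ y)) []"
    using assms(1) in_lists unfolding right_cube_condition_def by (metis append_in_lists_conv)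
  then show ?thesis
    using in_lists
    by (subst (asm) right_reverses_Nil_iff_grid) auto
qed

text \<open>These assumptions will be checked for \<open>R\<close> as well as for its mirror image.
  \<open>L\<close> is the map \<lambda> read on words, and \<open>complement_cancel\<close> is the
  part of (i) about equal first letters.\<close>

locale cube_presentation =
  fixes S :: "'a set" and R :: "'a list set set" and L :: "'a list \<Rightarrow> nat"
  assumes presentation: "semigroup_presentation S R"
    and L_cong: "(u, v) \<in> monoid_cong S R \<Longrightarrow> L u = L v"
    and L_append: "u \<in> lists S \<Longrightarrow> v \<in> lists S \<Longrightarrow> L u + L v \<le> L (u @ v)"
    and L_letter: "s \<in> S \<Longrightarrow> 1 \<le> L [s]"
    and cube: "s \<in> S \<Longrightarrow> s' \<in> S \<Longrightarrow> s'' \<in> S \<Longrightarrow> right_cube_condition S R [s] [s'] [s'']"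
    and complement_cancel: "complement S R s s v' v \<Longrightarrow> v' = v"
begin

section \<open>The monoid congruence and reversing to the empty word\<close>

definition cong (infix \<open>\<sim>\<close> 50) where "u \<sim> v \<longleftrightarrow> (u, v) \<in> monoid_cong S R"

lemma cong_refl: "u \<in> lists S \<Longrightarrow> u \<sim> u"
  unfolding cong_def monoid_cong_def by (rule word_cong.refl)

lemma cong_sym: "u \<sim> v \<Longrightarrow> v \<sim> u"
  unfolding cong_def monoid_cong_def by (rule word_cong.sym)

lemma cong_trans [trans]: "u \<sim> v \<Longrightarrow> v \<sim> w \<Longrightarrow> u \<sim> w"
  unfolding cong_def monoid_cong_def by (rule word_cong.trans)

lemma cong_append: "u \<sim> u' \<Longrightarrow> v \<sim> v' \<Longrightarrow> u @ v \<sim> u' @ v'"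
  unfolding cong_def monoid_cong_def by (rule word_cong.append)

lemma cong_in_lists: "u \<sim> v \<Longrightarrow> u \<in> lists S \<and> v \<in> lists S"
  unfolding cong_def monoid_cong_def by (rule word_cong_in_lists)

lemma cong_append_left: "u \<sim> v \<Longrightarrow> w \<in> lists S \<Longrightarrow> w @ u \<sim> w @ v"
  by (intro cong_append cong_refl)

lemma cong_append_right: "u \<sim> v \<Longrightarrow> w \<in> lists S \<Longrightarrow> u @ w \<sim> v @ w"
  by (intro cong_append cong_refl)

text \<open>Every cell is a relation or trivial, so the two paths around a grid represent the same
  element of the monoid.\<close>

lemma grid_imp_cong: "grid S R u u' v' v \<Longrightarrow> u @ v' \<sim> u' @ v"
proof (induction rule: grid.induct)
  case (cell s s' v' v)
  then consider "(s # v', s' # v) \<in> {(v, v'). {v, v'} \<in> R}" "s # v' \<in> lists S" "s' # v \<in> lists S"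
    | "s = s'" "s \<in> S" "v' = []" "v = []"
    by (auto simp: complement_def)
  then show ?case
    by cases (simp_all add: cong_def monoid_cong_def word_cong.base word_cong.refl)
next
  case (horizontal u u1 a b u2 c d)
  then have "u @ a @ c \<sim> u1 @ b @ c"
    using cong_append_right[OF horizontal.IH(1), of c] by (simp add: grid_in_lists)
  also have "\<dots> \<sim> u1 @ u2 @ d"
    using cong_append_left[OF horizontal.IH(2), of u1] horizontal.hyps by (simp add: grid_in_lists)
  finally show ?case by simp
next
  case (vertical u1 u a b u2 c d)
  then have "u1 @ u2 @ c \<sim> u1 @ a @ d"
    using cong_append_left[OF vertical.IH(2), of u1] by (simp add: grid_in_lists)
  also have "\<dots> \<sim> u @ b @ d"
    using cong_append_right[OF vertical.IH(1), of d] vertical.hyps by (simp add: grid_in_lists)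
  finally show ?case by simp
qed (simp_all add: cong_refl)

lemma L_grid: "grid S R u u' [] [] \<Longrightarrow> L u = L u'"
  using grid_imp_cong[of u u' "[]" "[]"] L_cong by (simp add: cong_def)

lemma L_Cons: "s \<in> S \<Longrightarrow> u \<in> lists S \<Longrightarrow> L u < L (s # u)"
  using L_append[of "[s]" u] L_letter[of s] by simp

lemma L_append_le: "u \<in> lists S \<Longrightarrow> v \<in> lists S \<Longrightarrow> L v \<le> L (u @ v)"
  using L_append[of u v] by simp

text \<open>Write \<open>x\<close> ~ \<open>y\<close> when \<open>x\<inverse> y\<close> reverses to
  the empty word. Induction is on the value of \<open>L\<close> at the middle word: \<open>L\<close>
  agrees on words related by ~ and drops when a first letter is removed, so ~ may be chained freely
  on the tails. The cube condition supplies a cell for the first letters of \<open>u\<close> and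
  \<open>u'\<close>, and the tails are then matched with its sides.\<close>

lemma grid_Nil_Nil_trans:
  "grid S R u u'' [] [] \<Longrightarrow> grid S R u'' u' [] [] \<Longrightarrow> grid S R u u' [] []"
proof (induction "L u''" arbitrary: u u'' u' rule: less_induct)
  case less
  show ?case
  proof (cases "u = [] \<or> u'' = [] \<or> u' = []")
    case True
    with less.prems show ?thesis
      by (auto simp: grid_Nil_left_iff grid_Nil_right_iff)
  next
    case False
    then obtain s t s'' t'' s' t' where
      u: "u = s # t" and u'': "u'' = s'' # t''" and u': "u' = s' # t'"
      by (meson list.exhaust)
    from less.prems obtain v' v a b
      where v: "complement S R s s'' v' v" "grid S R t v' [] a" "grid S R v t'' b []" "grid S R a b [] []"
      unfolding u u'' grid_Nil_Nil_Cons by blast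
    from less.prems obtain w' w c d
      where w: "complement S R s'' s' w' w" "grid S R t'' w' [] c" "grid S R w t' d []" "grid S R c d [] []"
      unfolding u' u'' grid_Nil_Nil_Cons by blast
    have in_lists: "s \<in> S" "s' \<in> S" "s'' \<in> S" "t \<in> lists S" "t' \<in> lists S" "t'' \<in> lists S"
      "v \<in> lists S" "v' \<in> lists S" "w \<in> lists S" "w' \<in> lists S"
      "a \<in> lists S" "b \<in> lists S" "c \<in> lists S" "d \<in> lists S"
      using v w by (auto simp: complement_def dest: grid_in_lists)
    have Lt: "L t < L u''" "L t'' < L u''" "L t' < L u''"
      using L_Cons[of s t] L_Cons[of s'' t''] L_Cons[of s' t'] in_lists
        L_grid[OF less.prems(1)] L_grid[OF less.prems(2)]
      unfolding u u' u'' by simp_all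
    have IH: "grid S R x z [] []" if "grid S R x y [] []" "grid S R y z [] []" "L y < L u''" for x y z
      using less.hyps[OF that(3,1,2)] .
    have sym: "grid S R x y [] [] \<Longrightarrow> grid S R y x [] []" for x y
      by (rule grid_sym)
    have append: "grid S R x (y @ n) [] []" if "grid S R x y [] m" "grid S R m n [] []" for x y m n
      using that grid_append_Nil_Nil by blast
    \<comment> \<open>The two given grids, without their first letters, say that \<open>t\<close> ~
      \<open>v' @ a\<close>, \<open>v @ a\<close> ~ \<open>t''\<close> ~ \<open>w' @ c\<close> and
      \<open>t'\<close> ~ \<open>w @ c\<close>.\<close>
    have 1: "grid S R t (v' @ a) [] []"
      using append[OF v(2) grid_refl] in_lists by blast
    have 2: "grid S R (v @ a) t'' [] []"
      using sym[OF append[OF grid_sym[OF v(3)] sym[OF v(4)]]] .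
    have 3: "grid S R t'' (w' @ c) [] []"
      using append[OF w(2) grid_refl] in_lists by blast
    have 4: "grid S R t' (w @ c) [] []"
      using append[OF grid_sym[OF w(3)] sym[OF w(4)]] .
    \<comment> \<open>Chaining through \<open>t''\<close> gives \<open>v @ a\<close> ~
      \<open>w' @ c\<close>. Cutting this grid isolates the face of the cube on \<open>v\<close> and
      \<open>w'\<close>, with the remainder \<open>d'\<close> common to both sides.\<close>
    from IH[OF 2 3 Lt(2)] obtain e where e: "grid S R (v @ a) w' [] e" "grid S R e c [] []"
      unfolding grid_append_Nil_Nil by blast
    from grid_split_left[OF e(1)]
    obtain y' y d' where y: "grid S R v w' y' y" "grid S R a y' [] d'" "e = y @ d'"
      by blast
    have in_lists': "y \<in> lists S" "y' \<in> lists S" "d' \<in> lists S" "e \<in> lists S"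
      using y e by (auto dest: grid_in_lists)
    have "grid S R (s # v' @ y') (s' # w @ y) [] []"
      using right_cube_condition_grid[OF cube v(1) w(1) y(1)] in_lists by blast
    \<comment> \<open>Appending \<open>d'\<close> makes the tails of the two words from the cube
      condition equivalent to \<open>t\<close> and \<open>t'\<close>. Removing the first letters
      then produces the cell with sides \<open>x'\<close> and \<open>x\<close>.\<close>
    from grid_append_right_Nil_Nil[OF this in_lists'(3)]
    have "grid S R (s # v' @ y' @ d') (s' # w @ y @ d') [] []"
      by simp
    then obtain x' x f g where x: "complement S R s s' x' x" "grid S R (v' @ y' @ d') x' [] f"
      "grid S R x (w @ y @ d') g []" "grid S R f g [] []"
      unfolding grid_Nil_Nil_Cons by blast
    have in_lists'': "x \<in> lists S" "x' \<in> lists S" "f \<in> lists S" "g \<in> lists S"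
      using x by (auto simp: complement_def dest: grid_in_lists)
    have "grid S R a (y' @ d') [] []"
      using append[OF y(2) grid_refl] in_lists' by blast
    from grid_append_left_Nil_Nil[OF this in_lists(8)]
    have 5: "grid S R t (v' @ y' @ d') [] []"
      using IH 1 L_grid[OF 1] Lt by simp
    have "grid S R (w @ c) (w @ y @ d') [] []"
      using grid_append_left_Nil_Nil[OF sym[OF e(2)] in_lists(9)] y by simp
    then have 6: "grid S R t' (w @ y @ d') [] []"
      using IH[OF 4] L_grid[OF 4] Lt by simp
    have "grid S R (v' @ y' @ d') (x' @ f) [] []"
      using append[OF x(2) grid_refl] in_lists'' by blast
    then have 7: "grid S R t (x' @ f) [] []"
      using IH[OF 5] L_grid[OF 5] Lt by simp
    have "grid S R (w @ y @ d') (x @ f) [] []"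
      using append[OF grid_sym[OF x(3)] sym[OF x(4)]] .
    then have 8: "grid S R t' (x @ f) [] []"
      using IH[OF 6] L_grid[OF 6] Lt by simp
    obtain f1 f2 where f: "grid S R t x' [] f1" "grid S R f1 f [] []"
      "grid S R t' x [] f2" "grid S R f2 f [] []"
      using 7 8 unfolding grid_append_Nil_Nil by blast
    \<comment> \<open>The remainders \<open>f1\<close> and \<open>f2\<close> of \<open>t\<close> and
      \<open>t'\<close> beyond this cell are both related to \<open>f\<close>, which is the middle
      word of the last chaining.\<close>
    have "L f < L u''"
      using L_append_le[of x' f] in_lists'' L_grid[OF 7] Lt by simp
    then have "grid S R f1 f2 [] []"
      using IH[OF f(2) sym[OF f(4)]] by blast
    with x(1) f(1) grid_sym[OF f(3)] show ?thesis
      unfolding u u' grid_Nil_Nil_Cons by blast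
  qed
qed

text \<open>Once transitivity is known, reversing to the empty word is a congruence containing
  \<open>R\<close>, hence contains the least one.\<close>

theorem complete:
  assumes "u \<sim> v"
  shows "grid S R u v [] []"
  using assms unfolding cong_def monoid_cong_def
proof (induction rule: word_cong.induct)
  case (base u v)
  with presentation have "u \<noteq> []" "v \<noteq> []"
    unfolding semigroup_presentation_def by (auto simp: doubleton_eq_iff)
  then obtain s t s' t' where "u = s # t" "v = s' # t'"
    by (meson list.exhaust)
  with base have "complement S R s s' t t'" "t \<in> lists S" "t' \<in> lists S"
    by (auto simp: complement_def)
  then show ?case
    unfolding \<open>u = _\<close> \<open>v = _\<close> grid_Nil_Nil_Cons
    by (intro exI[of _ t] exI[of _ t'] exI[of _ "[]"]) (simp add: grid_refl)
next
  case (append u u' v v')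
  then have "u' \<in> lists S" "v \<in> lists S"
    by (auto dest: grid_in_lists)
  then show ?case
    using append.IH by (meson grid_Nil_Nil_trans grid_append_left_Nil_Nil grid_append_right_Nil_Nil)
qed (auto intro: grid_refl grid_sym grid_Nil_Nil_trans)

lemma cong_iff_grid: "u \<sim> v \<longleftrightarrow> grid S R u v [] []"
  using complete grid_imp_cong by fastforce

text \<open>The upper left cell of the grid has the same letter on its left and top sides, so its
  outputs agree by \<open>complement_cancel\<close>. The rest of the grid then connects
  \<open>u\<close> with \<open>v\<close>.\<close>

lemma cong_Cons_cancel:
  assumes "s # u \<sim> s # v"
  shows "u \<sim> v"
proof -
  obtain x' x a b where x: "complement S R s s x' x" "grid S R u x' [] a" "grid S R x v b []"
    "grid S R a b [] []"
    using complete[OF assms] unfolding grid_Nil_Nil_Cons by blast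
  have "x' = x" using complement_cancel x(1) .
  moreover have "u \<sim> x' @ a" "x @ b \<sim> v"
    using grid_imp_cong[OF x(2)] grid_imp_cong[OF x(3)] by simp_all
  moreover have "x' @ a \<sim> x' @ b"
    using grid_imp_cong[OF x(4)] grid_in_lists[OF x(2)] by (auto intro: cong_append_left)
  ultimately show ?thesis
    using cong_trans by blast
qed

lemma cong_append_cancel: "w @ u \<sim> w @ v \<Longrightarrow> u \<sim> v"
  by (induction w) (auto dest: cong_Cons_cancel)

end

section \<open>Mirror images\<close>

lemma rev_pos_word: "rev (pos_word u) = pos_word (rev u)"
  by (simp add: pos_word_def rev_map)

lemma rev_inv_word: "rev (inv_word u) = inv_word (rev u)"
  by (simp add: inv_word_def rev_map)

lemma rev_in_lists [simp]: "rev u \<in> lists S \<longleftrightarrow> u \<in> lists S"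
  by (simp add: in_lists_conv_set)

lemma doubleton_in_image_rev: "{u, v} \<in> (`) rev ` R \<longleftrightarrow> {rev u, rev v} \<in> R"
proof
  assume "{u, v} \<in> (`) rev ` R"
  then obtain r where "r \<in> R" "{u, v} = rev ` r" by blast
  then have "rev ` {u, v} = r"
    by (simp add: image_image)
  with \<open>r \<in> R\<close> show "{rev u, rev v} \<in> R" by simp
next
  assume "{rev u, rev v} \<in> R"
  then have "rev ` {rev u, rev v} \<in> (`) rev ` R" by blast
  then show "{u, v} \<in> (`) rev ` R" by simp
qed

text \<open>Reading a signed word backwards keeps the signs, so a factor
  \<open>s\<inverse> s'\<close> becomes \<open>s' s\<inverse>\<close>, and relations on first
  letters become relations on last letters.\<close>

lemma right_rev_step_mirror:
  assumes "right_rev_step S ((`) rev ` R) w w'"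
  shows "left_rev_step S R (rev w) (rev w')"
  using assms
proof (induction rule: right_rev_step.induct)
  case (relation s s' v v' x y)
  then have "left_rev_step S R (rev y @ [Pos s', Neg s] @ rev x)
      (rev y @ inv_word (rev v) @ pos_word (rev v') @ rev x)"
    by (intro left_rev_step.relation) (auto simp: doubleton_in_image_rev insert_commute)
  then show ?case
    by (simp add: rev_pos_word rev_inv_word)
next
  case (deletion s x y)
  from left_rev_step.deletion[OF this, of R "rev y" "rev x"] show ?case by simp
qed

lemma left_rev_step_mirror:
  assumes "left_rev_step S R w w'"
  shows "right_rev_step S ((`) rev ` R) (rev w) (rev w')"
  using assms
proof (induction rule: left_rev_step.induct)
  case (relation s s' v v' x y)
  then have "right_rev_step S ((`) rev ` R) (rev y @ [Neg s, Pos s'] @ rev x)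
      (rev y @ pos_word (rev v') @ inv_word (rev v) @ rev x)"
    by (intro right_rev_step.relation) (auto simp: doubleton_in_image_rev insert_commute)
  then show ?case
    by (simp add: rev_pos_word rev_inv_word)
next
  case (deletion s x y)
  from right_rev_step.deletion[OF this, of _ "rev y" "rev x"] show ?case by simp
qed

lemma right_reverses_mirror:
  "right_reverses S ((`) rev ` R) w w' \<longleftrightarrow> left_reverses S R (rev w) (rev w')"
proof
  assume "right_reverses S ((`) rev ` R) w w'"
  then show "left_reverses S R (rev w) (rev w')"
    unfolding right_reverses_def left_reverses_def
    by (induction rule: rtranclp_induct)
      (auto intro: rtranclp.rtrancl_into_rtrancl right_rev_step_mirror)
next
  have "right_reverses S ((`) rev ` R) (rev x) (rev y)" if "left_reverses S R x y" for x y
    using that unfolding right_reverses_def left_reverses_def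
    by (induction rule: rtranclp_induct)
      (auto intro: rtranclp.rtrancl_into_rtrancl left_rev_step_mirror)
  then show "left_reverses S R (rev w) (rev w') \<Longrightarrow> right_reverses S ((`) rev ` R) w w'"
    by fastforce
qed

text \<open>Reading \<open>u\<inverse> u'' u''\<inverse> u'\<close> backwards puts the mirror image
  of \<open>u'\<close> in front, which is why the first two words of the triple trade
  places.\<close>

lemma right_cube_condition_mirror:
  assumes "left_cube_condition S R (rev u') (rev u) (rev u'')"
  shows "right_cube_condition S ((`) rev ` R) u u' u''"
  unfolding right_cube_condition_def right_reverses_mirror
proof (intro ballI impI)
  fix v v'
  assume in_lists: "v \<in> lists S" "v' \<in> lists S"
    and rev: "left_reverses S R (rev (inv_word u @ pos_word u'' @ inv_word u'' @ pos_word u'))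
      (rev (pos_word v' @ inv_word v))"
  have "left_reverses S R (pos_word (rev v @ rev u') @ inv_word (rev v' @ rev u)) []"
    using assms[unfolded left_cube_condition_def, rule_format, of "rev v" "rev v'"] rev in_lists
    by (simp add: rev_pos_word rev_inv_word)
  then show "left_reverses S R (rev (inv_word (u @ v') @ pos_word (u' @ v))) (rev [])"
    by (simp add: rev_pos_word rev_inv_word)
qed

lemma monoid_cong_mirror:
  assumes "(u, v) \<in> monoid_cong S R"
  shows "(rev u, rev v) \<in> monoid_cong S ((`) rev ` R)"
  using assms unfolding monoid_cong_def
proof (induction rule: word_cong.induct)
  case (base u v)
  then show ?case
    by (intro word_cong.base) (auto simp: doubleton_in_image_rev)
qed (auto intro: word_cong.refl word_cong.sym word_cong.trans word_cong.append)

lemma image_rev_image_rev: "(`) rev ` (`) rev ` R = R"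
  by (simp add: image_image)

section \<open>Fractions\<close>

text \<open>These are the Ore conditions: cancellation on both sides, and right common multiples,
  which are read off from the grids given by \<open>total\<close>.\<close>

locale ore_presentation = cube_presentation S R L
  for S :: "'a set" and R :: "'a list set set" and L :: "'a list \<Rightarrow> nat" +
  assumes right_cancel: "u @ w \<sim> v @ w \<Longrightarrow> u \<sim> v"
    and total: "u \<in> lists S \<Longrightarrow> u' \<in> lists S \<Longrightarrow> \<exists>v' v. grid S R u u' v' v"
begin

lemma common_multiple:
  assumes "u \<in> lists S" "v \<in> lists S"
  obtains x y where "x \<in> lists S" "y \<in> lists S" "u @ x \<sim> v @ y"
  using total[OF assms] grid_imp_cong grid_in_lists by metis

text \<open>A pair \<open>(p, q)\<close> stands for the right fraction \<open>p q\<inverse>\<close>.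
  This is the usual equality of fractions: a common expansion of numerator and denominator.\<close>

definition frac_eq :: "'a list \<times> 'a list \<Rightarrow> 'a list \<times> 'a list \<Rightarrow> bool" where
  "frac_eq f g \<longleftrightarrow> (\<exists>x\<in>lists S. \<exists>y\<in>lists S. fst f @ x \<sim> fst g @ y \<and> snd f @ x \<sim> snd g @ y)"

lemma frac_eq_refl: "p \<in> lists S \<Longrightarrow> q \<in> lists S \<Longrightarrow> frac_eq (p, q) (p, q)"
  unfolding frac_eq_def by (intro bexI[of _ "[]"]) (auto intro: cong_refl)

lemma frac_eq_sym: "frac_eq f g \<Longrightarrow> frac_eq g f"
  unfolding frac_eq_def using cong_sym by blast

text \<open>A common multiple of \<open>y\<close> and \<open>z\<close>, the two factors by which
  \<open>g\<close> is expanded, merges both expansions. The same computation serves numerators and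
  denominators.\<close>

lemma frac_eq_trans:
  assumes "frac_eq f g" "frac_eq g h"
  shows "frac_eq f h"
proof -
  obtain x y where 1: "x \<in> lists S" "y \<in> lists S" "fst f @ x \<sim> fst g @ y" "snd f @ x \<sim> snd g @ y"
    using assms(1) unfolding frac_eq_def by blast
  obtain z w where 2: "z \<in> lists S" "w \<in> lists S" "fst g @ z \<sim> fst h @ w" "snd g @ z \<sim> snd h @ w"
    using assms(2) unfolding frac_eq_def by blast
  obtain m n where 3: "m \<in> lists S" "n \<in> lists S" "y @ m \<sim> z @ n"
    using common_multiple 1 2 by metis
  have *: "a @ x @ m \<sim> c @ w @ n" if "a @ x \<sim> b @ y" "b @ z \<sim> c @ w" for a b c
  proof -
    have "b \<in> lists S"
      using cong_in_lists[OF that(1)] by simp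
    have "a @ x @ m \<sim> b @ y @ m"
      using cong_append_right[OF that(1) 3(1)] by simp
    also have "\<dots> \<sim> b @ z @ n"
      using cong_append_left[OF 3(3) \<open>b \<in> lists S\<close>] .
    also have "\<dots> \<sim> c @ w @ n"
      using cong_append_right[OF that(2) 3(2)] by simp
    finally show ?thesis .
  qed
  show ?thesis
    unfolding frac_eq_def
    using * 1 2 3 by (intro bexI[of _ "x @ m"] bexI[of _ "w @ n"]) auto
qed

text \<open>The words \<open>a\<close> and \<open>b\<close> satisfy
  \<open>q\<inverse> v = a b\<inverse>\<close>, so \<open>(p @ a, b)\<close> is the fraction
  \<open>p q\<inverse>\<close> times \<open>v\<close>; likewise for the other one. The claim is that
  multiplying equal fractions by equivalent positive words gives equal fractions.\<close>

lemma frac_eq_append_pos: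
  assumes "p @ x \<sim> r @ y" "q @ x \<sim> t @ y" "x \<in> lists S" "y \<in> lists S"
    and "q @ a \<sim> v @ b" "t @ c \<sim> v' @ d" "v \<sim> v'"
  shows "frac_eq (p @ a, b) (r @ c, d)"
proof -
  have in_lists: "p \<in> lists S" "r \<in> lists S" "q \<in> lists S" "t \<in> lists S" "a \<in> lists S"
    "b \<in> lists S" "c \<in> lists S" "d \<in> lists S" "v \<in> lists S" "v' \<in> lists S"
    using assms(1,2,5,6)[THEN cong_in_lists] by auto
  obtain e f where e: "e \<in> lists S" "f \<in> lists S" "a @ e \<sim> x @ f"
    using common_multiple assms in_lists by metis
  obtain g h where g: "g \<in> lists S" "h \<in> lists S" "c @ g \<sim> (y @ f) @ h"
    using common_multiple[of c "y @ f"] assms in_lists e by auto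
  \<comment> \<open>Used twice: with \<open>p\<close> and \<open>r\<close> it equates the new
    numerators, and with \<open>q\<close> and \<open>t\<close> it prepares the comparison of the new
    denominators.\<close>
  have *: "k @ a @ e @ h \<sim> l @ c @ g" if "k @ x \<sim> l @ y" for k l
  proof -
    have kl: "k \<in> lists S" "l \<in> lists S"
      using cong_in_lists[OF that] by auto
    have "k @ a @ e @ h \<sim> k @ x @ f @ h"
      using cong_append_left[OF cong_append_right[OF e(3) g(2)] kl(1)] by simp
    also have "\<dots> \<sim> l @ y @ f @ h"
      using cong_append_right[OF that, of "f @ h"] e g by simp
    also have "\<dots> \<sim> l @ c @ g"
      using cong_append_left[OF cong_sym[OF g(3)] kl(2)] by simp
    finally show ?thesis .
  qed
  \<comment> \<open>The expanded denominators are first compared after multiplication by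
    \<open>v\<close> on the left; left cancellation then removes \<open>v\<close>.\<close>
  have "v @ b @ e @ h \<sim> q @ a @ e @ h"
    using cong_append_right[OF cong_sym[OF assms(5)], of "e @ h"] e g by simp
  also have "\<dots> \<sim> t @ c @ g"
    using * assms(2) .
  also have "\<dots> \<sim> v' @ d @ g"
    using cong_append_right[OF assms(6) g(1)] by simp
  also have "\<dots> \<sim> v @ d @ g"
    using cong_append_right[OF cong_sym[OF assms(7)], of "d @ g"] in_lists g by simp
  finally have "b @ e @ h \<sim> d @ g"
    by (rule cong_append_cancel)
  then show ?thesis
    unfolding frac_eq_def using *[OF assms(1)] e g
    by (intro bexI[of _ "e @ h"] bexI[of _ g]) auto
qed

text \<open>Reading a signed word is right multiplication by it; this is the proof that the
  multiplication is well defined on classes of fractions.\<close>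

lemma run_frac_eq:
  "run S R f w f' \<Longrightarrow> run S R g w g' \<Longrightarrow> frac_eq f g \<Longrightarrow> frac_eq f' g'"
proof (induction arbitrary: g rule: run.induct)
  case (Nil x)
  then show ?case by (simp add: run_Nil_iff)
next
  case (Neg s p q w x)
  obtain r t where g: "g = (r, t)" by fastforce
  obtain x y where "x \<in> lists S" "y \<in> lists S" "p @ x \<sim> r @ y" "q @ x \<sim> t @ y"
    using Neg.prems g unfolding frac_eq_def by auto
  moreover from this have "(s # q) @ x \<sim> (s # t) @ y"
    using cong_append_left[of "q @ x" "t @ y" "[s]"] Neg.hyps by simp
  ultimately have "frac_eq (p, s # q) (r, s # t)"
    unfolding frac_eq_def by auto
  then show ?case
    using Neg.prems Neg.IH g by (auto simp: run_Neg_iff)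
next
  case (Pos q s a b p w x)
  obtain r t where g: "g = (r, t)" by fastforce
  obtain c d where c: "grid S R t [s] c d" "run S R (r @ c, d) w g'"
    using Pos.prems g by (auto simp: run_Pos_iff)
  obtain x y where "x \<in> lists S" "y \<in> lists S" "p @ x \<sim> r @ y" "q @ x \<sim> t @ y"
    using Pos.prems g unfolding frac_eq_def by auto
  then have "frac_eq (p @ a, b) (r @ c, d)"
    using frac_eq_append_pos[where v = "[s]" and v' = "[s]"] grid_imp_cong[OF Pos.hyps(1)]
      grid_imp_cong[OF c(1)] grid_in_lists[OF c(1)] cong_refl by blast
  with c Pos.IH show ?case by blast
qed

text \<open>The defining relations of the group hold for the action on fractions. For
  \<open>s s\<inverse>\<close> and \<open>s\<inverse> s\<close> the result is the fraction
  \<open>p q\<inverse>\<close> expanded by \<open>a\<close>.\<close>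

lemma run_frac_eq_base:
  assumes "(w, w') \<in> group_relations S R" "w \<in> lists (signed_alphabet S)"
    "w' \<in> lists (signed_alphabet S)" "p \<in> lists S" "q \<in> lists S"
    and "run S R (p, q) w f" "run S R (p, q) w' g"
  shows "frac_eq f g"
proof -
  from assms(1) consider v v' where "w = pos_word v" "w' = pos_word v'" "{v, v'} \<in> R"
    | s where "w = [Pos s, Neg s]" "w' = []" "s \<in> S"
    | s where "w = [Neg s, Pos s]" "w' = []" "s \<in> S"
    unfolding group_relations_def by blast
  then show ?thesis
  proof cases
    case 1
    then obtain a b c d where *: "grid S R q v a b" "f = (p @ a, b)" "grid S R q v' c d" "g = (p @ c, d)"
      using assms by (auto simp: run_pos_word)
    then have "v \<sim> v'"
      using 1 by (auto simp: cong_def monoid_cong_def intro!: word_cong.base dest: grid_in_lists)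
    then show ?thesis
      using * frac_eq_append_pos[of p "[]" p "[]" q q a v b c v' d] assms cong_refl
        grid_imp_cong[OF *(1)] grid_imp_cong[OF *(3)] by simp
  next
    case 2
    then obtain a b where *: "grid S R q [s] a b" "f = (p @ a, s # b)" "g = (p, q)"
      using assms by (auto simp: run_Pos_iff run_Neg_iff run_Nil_iff)
    then have "a \<in> lists S"
      by (auto dest: grid_in_lists)
    moreover from this have "p @ a \<sim> p @ a"
      using assms(4) by (intro cong_refl) simp
    moreover have "s # b \<sim> q @ a"
      using cong_sym[OF grid_imp_cong[OF *(1)]] by simp
    ultimately show ?thesis
      unfolding frac_eq_def * by (intro bexI[of _ a] bexI[of _ "[]"]) simp_all
  next
    case 3
    then obtain a b where *: "grid S R (s # q) [s] a b" "f = (p @ a, b)" "g = (p, q)"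
      using assms by (auto simp: run_Pos_iff run_Neg_iff run_Nil_iff)
    then have "a \<in> lists S"
      by (auto dest: grid_in_lists)
    moreover from this have "p @ a \<sim> p @ a"
      using assms(4) by (intro cong_refl) simp
    \<comment> \<open>The grid gives \<open>s q a\<close> \<equiv> \<open>s b\<close>, and
      \<open>s\<close> is cancelled on the left.\<close>
    moreover have "b \<sim> q @ a"
      using cong_sym[OF cong_Cons_cancel[of s "q @ a" b]] grid_imp_cong[OF *(1)] by simp
    ultimately show ?thesis
      unfolding frac_eq_def * by (intro bexI[of _ a] bexI[of _ "[]"]) simp_all
  qed
qed

text \<open>The action of signed words on fractions factors through the group. The starting fraction
  stays arbitrary in the induction because, in a concatenation, the second word starts where the
  first has ended.\<close>

lemma group_cong_imp_frac_eq:
  assumes "(w, w') \<in> group_cong S R"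
    and "p \<in> lists S" "q \<in> lists S" "run S R (p, q) w f" "run S R (p, q) w' g"
  shows "frac_eq f g"
  using assms unfolding group_cong_def
proof (induction arbitrary: p q f g rule: word_cong.induct)
  case (base u v)
  then show ?case by (blast intro: run_frac_eq_base)
next
  case (refl u)
  then show ?case by (blast intro: run_frac_eq frac_eq_refl)
next
  case (sym u v)
  then show ?case by (blast intro: frac_eq_sym)
next
  case (trans u v w)
  obtain h where "run S R (p, q) v h"
    using run_total[OF total] word_cong_in_lists[OF trans.hyps(1)] trans.prems by blast
  with trans show ?case by (blast intro: frac_eq_trans)
next
  case (append u u' v v')
  obtain m m' where m: "run S R (p, q) u m" "run S R m v f" "run S R (p, q) u' m'" "run S R m' v' g"
    using append.prems by (auto simp: run_append)
  obtain p' q' where m': "m' = (p', q')" by fastforce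
  have in_lists: "p' \<in> lists S" "q' \<in> lists S"
    using run_in_lists[OF m(3)] append.prems m' by auto
  \<comment> \<open>The intermediate run reads \<open>u'\<close> and then \<open>v\<close>, so that
    only one factor changes at a time.\<close>
  obtain h where h: "run S R m' v h"
    using run_total[OF total] word_cong_in_lists[OF append.hyps(2)] in_lists m' by blast
  have "frac_eq m m'"
    using append m by blast
  then have "frac_eq f h"
    using run_frac_eq m h by blast
  moreover have "frac_eq h g"
    using append.IH(2) in_lists m' h m by blast
  ultimately show ?case by (rule frac_eq_trans)
qed

text \<open>Acting on the fraction \<open>1\<close>, the word \<open>w\<close> yields both
  \<open>v' v\<inverse>\<close> and \<open>1\<close>. Equality of these fractions makes
  \<open>v\<close> and \<open>v'\<close> agree after multiplication by \<open>x\<close> on the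
  right, and right cancellation finishes.\<close>

lemma group_cong_Nil_imp_cong:
  assumes "(w, []) \<in> group_cong S R" "run S R ([], []) w (v', v)"
  shows "v \<sim> v'"
proof -
  have "frac_eq (v', v) ([], [])"
    using group_cong_imp_frac_eq[OF assms(1) _ _ assms(2)] by (auto simp: run_Nil_iff)
  then obtain x y where x: "v' @ x \<sim> y" "v @ x \<sim> y"
    unfolding frac_eq_def by auto
  then have "v @ x \<sim> v' @ x"
    using cong_sym cong_trans by blast
  then show ?thesis
    by (rule right_cancel)
qed

end

section \<open>The presented group\<close>

lemma pos_word_in_lists: "v \<in> lists S \<Longrightarrow> pos_word v \<in> lists (signed_alphabet S)"
  by (auto simp: pos_word_def signed_alphabet_def)

lemma inv_word_in_lists: "v \<in> lists S \<Longrightarrow> inv_word v \<in> lists (signed_alphabet S)"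
  by (auto simp: inv_word_def signed_alphabet_def)

lemma monoid_cong_imp_group_cong:
  assumes "(u, v) \<in> monoid_cong S R"
  shows "(pos_word u, pos_word v) \<in> group_cong S R"
  using assms unfolding monoid_cong_def group_cong_def
proof (induction rule: word_cong.induct)
  case (base u v)
  then show ?case
    by (intro word_cong.base pos_word_in_lists) (auto simp: group_relations_def)
next
  case (refl u)
  then show ?case
    by (intro word_cong.refl pos_word_in_lists)
qed (auto intro: word_cong.sym word_cong.trans word_cong.append)

lemma group_cong_context:
  assumes "(u, v) \<in> group_cong S R" "x \<in> lists (signed_alphabet S)" "y \<in> lists (signed_alphabet S)"
  shows "(x @ u @ y, x @ v @ y) \<in> group_cong S R"
  using assms unfolding group_cong_def by (intro word_cong.append word_cong.refl)

lemma group_cong_pos_inv: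
  "v \<in> lists S \<Longrightarrow> (pos_word v @ inv_word v, []) \<in> group_cong S R"
proof (induction v)
  case Nil
  then show ?case by (simp add: group_cong_def word_cong.refl)
next
  case (Cons s v)
  then have s: "Pos s \<in> signed_alphabet S" "Neg s \<in> signed_alphabet S"
    by (auto simp: signed_alphabet_def)
  have "([Pos s] @ (pos_word v @ inv_word v) @ [Neg s], [Pos s] @ [] @ [Neg s]) \<in> group_cong S R"
    using Cons s by (intro group_cong_context) auto
  moreover have "([Pos s, Neg s], []) \<in> group_cong S R"
    using Cons.prems s unfolding group_cong_def
    by (intro word_cong.base) (auto simp: group_relations_def)
  ultimately show ?case
    unfolding group_cong_def by (auto intro: word_cong.trans)
qed

lemma group_cong_inv_pos:
  "v \<in> lists S \<Longrightarrow> (inv_word v @ pos_word v, []) \<in> group_cong S R"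
proof (induction v)
  case Nil
  then show ?case by (simp add: group_cong_def word_cong.refl)
next
  case (Cons s v)
  have "([Neg s, Pos s], []) \<in> group_cong S R"
    using Cons.prems unfolding group_cong_def
    by (intro word_cong.base) (auto simp: group_relations_def signed_alphabet_def)
  then have "(inv_word v @ [Neg s, Pos s] @ pos_word v, inv_word v @ [] @ pos_word v) \<in> group_cong S R"
    using Cons.prems by (intro group_cong_context pos_word_in_lists inv_word_in_lists) auto
  with Cons show ?case
    unfolding group_cong_def by (auto intro: word_cong.trans)
qed

text \<open>Insert \<open>v v\<inverse>\<close> at the end, replace \<open>u' v\<close> by
  \<open>u v'\<close>, and cancel \<open>u\<inverse> u\<close>. With the words of a relation this
  justifies a reversing step.\<close>

lemma group_cong_swap:
  assumes "u \<in> lists S" "u' \<in> lists S" "v' \<in> lists S" "v \<in> lists S"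
    and "(u @ v', u' @ v) \<in> monoid_cong S R"
  shows "(inv_word u @ pos_word u', pos_word v' @ inv_word v) \<in> group_cong S R"
proof -
  note in_lists = assms(1-4)[THEN pos_word_in_lists] assms(1-4)[THEN inv_word_in_lists]
  have trans: "(x, z) \<in> group_cong S R" if "(x, y) \<in> group_cong S R" "(y, z) \<in> group_cong S R" for x y z
    using that unfolding group_cong_def by (rule word_cong.trans)
  have sym: "(y, x) \<in> group_cong S R" if "(x, y) \<in> group_cong S R" for x y
    using that unfolding group_cong_def by (rule word_cong.sym)
  have 1: "(inv_word u @ pos_word u', inv_word u @ pos_word (u' @ v) @ inv_word v) \<in> group_cong S R"
    using sym[OF group_cong_context[OF group_cong_pos_inv[OF assms(4), of R], of "inv_word u @ pos_word u'" "[]"]]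
      in_lists by simp
  have 2: "(inv_word u @ pos_word (u' @ v) @ inv_word v, inv_word u @ pos_word (u @ v') @ inv_word v)
      \<in> group_cong S R"
    using in_lists sym[OF monoid_cong_imp_group_cong[OF assms(5)]] by (intro group_cong_context)
  have 3: "(inv_word u @ pos_word (u @ v') @ inv_word v, pos_word v' @ inv_word v) \<in> group_cong S R"
    using group_cong_context[OF group_cong_inv_pos[OF assms(1), of R], of "[]" "pos_word v' @ inv_word v"]
      in_lists by simp
  show ?thesis
    using 1 2 3 trans by blast
qed

lemma right_reverses_imp_group_cong:
  assumes "right_reverses S R w w'" "w \<in> lists (signed_alphabet S)"
  shows "(w, w') \<in> group_cong S R"
  using assms(1) unfolding right_reverses_def
proof (induction rule: rtranclp_induct)
  case base
  then show ?case
    using assms(2) by (simp add: group_cong_def word_cong.refl)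
next
  case (step y z)
  have "y \<in> lists (signed_alphabet S)"
    using step.IH word_cong_in_lists unfolding group_cong_def by blast
  have "(y, z) \<in> group_cong S R"
    using step.hyps(2)
  proof cases
    case (relation s s' v v' x x')
    then have "([s] @ v', [s'] @ v) \<in> monoid_cong S R"
      unfolding monoid_cong_def by (intro word_cong.base) auto
    from group_cong_swap[OF _ _ _ _ this]
    have "([Neg s, Pos s'], pos_word v' @ inv_word v) \<in> group_cong S R"
      using relation by simp
    from group_cong_context[OF this, of x x'] show ?thesis
      using relation \<open>y \<in> _\<close> by simp
  next
    case (deletion s x x')
    with group_cong_inv_pos[of "[s]" S R] have "([Neg s, Pos s], []) \<in> group_cong S R"
      by simp
    from group_cong_context[OF this, of x x'] show ?thesis
      using deletion \<open>y \<in> _\<close> by simp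
  qed
  with step.IH show ?case
    unfolding group_cong_def by (rule word_cong.trans)
qed

lemma iso_class_eq_one_iff:
  assumes "group G" "\<phi> \<in> iso (presented_group S R) G" "w \<in> lists (signed_alphabet S)"
  shows "\<phi> (group_cong S R `` {w}) = \<one>\<^bsub>G\<^esub> \<longleftrightarrow> (w, []) \<in> group_cong S R"
proof -
  interpret G: group G by fact
  have in_carrier: "group_cong S R `` {x} \<in> carrier (presented_group S R)"
    if "x \<in> lists (signed_alphabet S)" for x
    using that by (auto simp: presented_group_def word_quotient_def group_cong_def intro: quotientI)
  let ?e = "group_cong S R `` {[]}"
  have e: "?e \<in> carrier (presented_group S R)"
    by (rule in_carrier) simp
  have hom: "\<phi> \<in> hom (presented_group S R) G"
    and inj: "inj_on \<phi> (carrier (presented_group S R))"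
    using assms(2) by (auto simp: iso_def bij_betw_def)
  \<comment> \<open>The class of the empty word is idempotent, and the only idempotent of the group
    \<open>G\<close> is its unit; this locates the image of the class under
    \<open>\<phi>\<close>.\<close>
  have "?e \<otimes>\<^bsub>presented_group S R\<^esub> ?e = ?e"
    unfolding presented_group_def group_cong_def by (simp add: mult_word_quotient)
  then have "\<phi> ?e \<otimes>\<^bsub>G\<^esub> \<phi> ?e = \<phi> ?e"
    using hom_mult[OF hom e e] by simp
  then have "\<phi> ?e = \<one>\<^bsub>G\<^esub>"
    using hom_in_carrier[OF hom e] by simp
  then have "\<phi> (group_cong S R `` {w}) = \<one>\<^bsub>G\<^esub> \<longleftrightarrow> group_cong S R `` {w} = ?e"
    using inj in_carrier[OF assms(3)] e by (metis inj_onD)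
  also have "\<dots> \<longleftrightarrow> (w, []) \<in> group_cong S R"
    unfolding group_cong_def
    using eq_equiv_class_iff[OF equiv_word_cong assms(3), of "[]"] by simp
  finally show ?thesis .
qed

theorem theorem3:
  fixes S :: "'a set" and R :: "'a list set set"
    and G :: "('g, 'm) monoid_scheme" and \<phi> :: "'a signed list set \<Rightarrow> 'g"
  assumes presentation: "semigroup_presentation S R"
    and group: "group G"
    and iso: "\<phi> \<in> iso (presented_group S R) G"
    and i: "\<And>s v v'. s \<in> S \<Longrightarrow> v \<in> lists S \<Longrightarrow> v' \<in> lists S \<Longrightarrow> v \<noteq> v' \<Longrightarrow>
      {s # v, s # v'} \<notin> R \<and> {v @ [s], v' @ [s]} \<notin> R"
    and ii: "\<exists>l :: 'a list set \<Rightarrow> nat.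
      (\<forall>x\<in>carrier (presented_monoid S R). \<forall>y\<in>carrier (presented_monoid S R).
        l (x \<otimes>\<^bsub>presented_monoid S R\<^esub> y) \<ge> l x + l y) \<and>
      (\<forall>s\<in>S. l (monoid_cong S R `` {[s]}) \<ge> 1)"
    and iii_distinct: "\<And>s s'. s \<in> S \<Longrightarrow> s' \<in> S \<Longrightarrow> s \<noteq> s' \<Longrightarrow>
      \<exists>\<^sub>\<le>\<^sub>1 r. r \<in> R \<and> (\<exists>v\<in>lists S. \<exists>v'\<in>lists S. r = {s # v', s' # v})"
    and iii_same: "\<And>s v v'. s \<in> S \<Longrightarrow> v \<in> lists S \<Longrightarrow> v' \<in> lists S \<Longrightarrow> {s # v', s # v} \<notin> R"
    and iv: "\<And>s s' s''. s \<in> S \<Longrightarrow> s' \<in> S \<Longrightarrow> s'' \<in> S \<Longrightarrow>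
      left_cube_condition S R [s] [s'] [s''] \<and> right_cube_condition S R [s] [s'] [s'']"
    and v: "\<exists>S' \<subseteq> lists S. (\<forall>s\<in>S. [s] \<in> S') \<and>
      (\<forall>u\<in>S'. \<forall>u'\<in>S'. \<exists>v\<in>S'. \<exists>v'\<in>S'.
        right_reverses S R (inv_word u @ pos_word u') (pos_word v' @ inv_word v))"
  shows "\<forall>w\<in>lists (signed_alphabet S).
    (\<exists>!(v, v'). v \<in> lists S \<and> v' \<in> lists S \<and>
      right_reverses S R w (pos_word v' @ inv_word v)) \<and>
    (\<forall>v\<in>lists S. \<forall>v'\<in>lists S. right_reverses S R w (pos_word v' @ inv_word v) \<longrightarrow>
      (\<phi> (group_cong S R `` {w}) = \<one>\<^bsub>G\<^esub> \<longleftrightarrow>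
        right_reverses S R (inv_word v @ pos_word v') []))"
proof -
  let ?C = "\<lambda>u. monoid_cong S R `` {u}"
  obtain l :: "'a list set \<Rightarrow> nat" where
    l_mult: "\<And>x y. x \<in> carrier (presented_monoid S R) \<Longrightarrow> y \<in> carrier (presented_monoid S R) \<Longrightarrow>
      l x + l y \<le> l (x \<otimes>\<^bsub>presented_monoid S R\<^esub> y)"
    and l_letter: "\<And>s. s \<in> S \<Longrightarrow> 1 \<le> l (?C [s])"
    using ii by blast
  \<comment> \<open>The map \<lambda> is pulled back from the monoid to words, where it becomes
    constant on congruence classes.\<close>
  define L where "L u = l (?C u)" for u
  have L_cong: "L u = L v" if "(u, v) \<in> monoid_cong S R" for u v
    using equiv_class_eq[OF equiv_word_cong that[unfolded monoid_cong_def]]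
    by (simp add: L_def monoid_cong_def)
  have L_append: "L u + L v \<le> L (u @ v)" if "u \<in> lists S" "v \<in> lists S" for u v
  proof -
    have C: "?C u \<in> carrier (presented_monoid S R)" "?C v \<in> carrier (presented_monoid S R)"
      using that by (auto simp: presented_monoid_def word_quotient_def monoid_cong_def intro: quotientI)
    have "?C u \<otimes>\<^bsub>presented_monoid S R\<^esub> ?C v = ?C (u @ v)"
      using that by (simp add: presented_monoid_def monoid_cong_def mult_word_quotient)
    with l_mult[OF C] show ?thesis
      by (simp add: L_def)
  qed
  have cancel: "v' = v" if "complement S R s s v' v" for s v' v
    using that i[of s v' v] unfolding complement_def by blast
  have cube: "right_cube_condition S R [s] [s'] [s'']" if "s \<in> S" "s' \<in> S" "s'' \<in> S" for s s' s''
    using iv that by blast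
  interpret cube_presentation S R L
  proof
    show "1 \<le> L [s]" if "s \<in> S" for s
      using l_letter[OF that] by (simp add: L_def)
  qed (fact presentation L_cong L_append cube cancel)+

  let ?R = "(`) rev ` R"
  \<comment> \<open>Mirroring exchanges the two sides of every product, so \<lambda> is evaluated at
    the reversed word and the left cube condition takes the place of the right one.\<close>
  interpret mirror: cube_presentation S ?R "\<lambda>u. L (rev u)"
  proof
    show "semigroup_presentation S ?R"
      unfolding semigroup_presentation_def
    proof (intro conjI ballI)
      show "S \<noteq> {}"
        using presentation by (simp add: semigroup_presentation_def)
      fix r
      assume "r \<in> ?R"
      then obtain r' where "r' \<in> R" "r = rev ` r'"
        by blast
      then have "\<exists>v\<in>lists S. \<exists>v'\<in>lists S. v \<noteq> [] \<and> v' \<noteq> [] \<and> r' = {v, v'}"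
        using presentation unfolding semigroup_presentation_def by (elim conjE bspec)
      then obtain v v'
        where "v \<in> lists S" "v' \<in> lists S" "v \<noteq> []" "v' \<noteq> []" "r' = {v, v'}"
        by (elim bexE conjE)
      with \<open>r = rev ` r'\<close> show "\<exists>v\<in>lists S. \<exists>v'\<in>lists S. v \<noteq> [] \<and> v' \<noteq> [] \<and> r = {v, v'}"
        by (intro bexI[of _ "rev v"] bexI[of _ "rev v'"]) simp_all
    qed
    show "L (rev u) = L (rev v)" if "(u, v) \<in> monoid_cong S ?R" for u v
      by (rule L_cong) (rule monoid_cong_mirror[OF that, unfolded image_rev_image_rev])
    show "L (rev u) + L (rev v) \<le> L (rev (u @ v))" if "u \<in> lists S" "v \<in> lists S" for u v
      using L_append[of "rev v" "rev u"] that by simp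
    show "1 \<le> L (rev [s])" if "s \<in> S" for s
      using l_letter[OF that] by (simp add: L_def)
    show "right_cube_condition S ?R [s] [s'] [s'']" if "s \<in> S" "s' \<in> S" "s'' \<in> S" for s s' s''
      using iv[of s' s s''] that by (intro right_cube_condition_mirror) simp
    show "v' = v" if "complement S ?R s s v' v" for s v' v
    proof -
      \<comment> \<open>A relation of the mirror image with equal first letters is a relation of
        \<open>R\<close> with equal last letters, which the second half of \<open>i\<close> excludes
        unless it is trivial.\<close>
      from that have "s \<in> S" "rev v' \<in> lists S" "rev v \<in> lists S"
        and "{rev v' @ [s], rev v @ [s]} \<in> R \<or> v' = v"
        by (simp_all add: complement_def doubleton_in_image_rev) blast
      with i[of s "rev v'" "rev v"] show ?thesis
        by (metis rev_is_rev_conv)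
    qed
  qed
  \<comment> \<open>Right cancellation is left cancellation in the mirror image, transported back by
    reading the words backwards.\<close>
  have right_cancel: "(u, v) \<in> monoid_cong S R" if "(u @ w, v @ w) \<in> monoid_cong S R" for u v w
  proof -
    have "(rev w @ rev u, rev w @ rev v) \<in> monoid_cong S ?R"
      using monoid_cong_mirror[OF that] by simp
    from monoid_cong_mirror[OF mirror.cong_append_cancel[unfolded mirror.cong_def, OF this]]
    show ?thesis
      by (simp add: image_rev_image_rev)
  qed

  obtain S' where S': "S' \<subseteq> lists S" "\<And>s. s \<in> S \<Longrightarrow> [s] \<in> S'"
    and closed: "\<And>u u'. u \<in> S' \<Longrightarrow> u' \<in> S' \<Longrightarrow> \<exists>v\<in>S'. \<exists>v'\<in>S'.
      right_reverses S R (inv_word u @ pos_word u') (pos_word v' @ inv_word v)"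
    using v by metis
  have total: "\<exists>v' v. grid S R u u' v' v" if "u \<in> lists S" "u' \<in> lists S" for u u'
  proof (rule grid_total[OF S' _ that])
    fix u u'
    assume "u \<in> S'" "u' \<in> S'"
    from closed[OF this] obtain a b where *: "a \<in> S'" "b \<in> S'"
      "right_reverses S R (inv_word u @ pos_word u') (pos_word b @ inv_word a)"
      by (elim bexE)
    with \<open>u \<in> S'\<close> S'(1) have "u \<in> lists S" "b \<in> lists S" "a \<in> lists S"
      by (simp_all add: subset_iff del: in_lists_conv_set)
    from right_reverses_iff_grid[OF this, of R u'] * show "\<exists>v\<in>S'. \<exists>v'\<in>S'. grid S R u u' v' v"
      by blast
  qed
  interpret ore_presentation S R L
  proof
    show "cong u v" if "cong (u @ w) (v @ w)" for u v w
      using right_cancel that unfolding cong_def by blast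
  qed (fact total)

  \<comment> \<open>For equal letters \<open>iii_same\<close> leaves only the trivial cell. For
    distinct letters uniqueness of the relation applies, and the differing first letters decide
    which word of the unordered pair is which.\<close>
  have complemented: "a = c \<and> b = d"
    if "complement S R s s' a b" "complement S R s s' c d" for s s' a b c d
  proof (cases "s = s'")
    case True
    with that iii_same[of s b a] iii_same[of s d c] show ?thesis
      unfolding complement_def by metis
  next
    case False
    with that have 1: "{s # a, s' # b} \<in> R" "{s # c, s' # d} \<in> R" "s \<in> S" "s' \<in> S"
      "a \<in> lists S" "b \<in> lists S" "c \<in> lists S" "d \<in> lists S"
      by (simp_all add: complement_def)
    have "{s # a, s' # b} = {s # c, s' # d}"
      by (rule Uniq_D[OF iii_distinct[OF 1(3,4) False]]) (use 1 in blast)+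
    with False show ?thesis
      by (auto simp: doubleton_eq_iff)
  qed
  show ?thesis
  proof (intro ballI conjI impI)
    fix w
    assume w: "w \<in> lists (signed_alphabet S)"
    obtain v' v where run: "run S R ([], []) w (v', v)"
      using run_total[OF total w, of "[]" "[]"] by auto
    have in_lists: "v' \<in> lists S" "v \<in> lists S"
      using run_in_lists[OF run] by auto
    show "\<exists>!(v, v'). v \<in> lists S \<and> v' \<in> lists S \<and>
        right_reverses S R w (pos_word v' @ inv_word v)"
    proof (rule ex1I[of _ "(v, v')"])
      show "case (v, v') of (v, v') \<Rightarrow> v \<in> lists S \<and> v' \<in> lists S \<and>
          right_reverses S R w (pos_word v' @ inv_word v)"
        using run in_lists by (simp add: right_reverses_iff_run)
    next
      fix x
      assume "case x of (v, v') \<Rightarrow> v \<in> lists S \<and> v' \<in> lists S \<and>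
        right_reverses S R w (pos_word v' @ inv_word v)"
      then have x: "fst x \<in> lists S" "snd x \<in> lists S"
        "right_reverses S R w (pos_word (snd x) @ inv_word (fst x))"
        by (simp_all only: case_prod_unfold)
      have "run S R ([], []) w (snd x, fst x)"
        using x(3) unfolding right_reverses_iff_run[OF x(2,1)] .
      have "(v', v) = (snd x, fst x)"
        by (rule run_functional[OF complemented run \<open>run S R ([], []) w (snd x, fst x)\<close>])
      then show "x = (v, v')"
        by (simp add: prod_eq_iff)
    qed
  next
    fix w v v'
    assume w: "w \<in> lists (signed_alphabet S)" and in_lists: "v \<in> lists S" "v' \<in> lists S"
      and rev: "right_reverses S R w (pos_word v' @ inv_word v)"
    have run: "run S R ([], []) w (v', v)"
      using rev unfolding right_reverses_iff_run[OF in_lists(2,1)] .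
    have "(w, []) \<in> group_cong S R" if "(v, v') \<in> monoid_cong S R"
    proof -
      have "(w, pos_word v' @ inv_word v) \<in> group_cong S R"
        using right_reverses_imp_group_cong rev w .
      \<comment> \<open>With both left words empty, \<open>group_cong_swap\<close> turns
        \<open>v'\<close> \<equiv> \<open>v\<close> into triviality of \<open>v' v\<inverse>\<close>
        in the group.\<close>
      moreover have "([] @ v', [] @ v) \<in> monoid_cong S R"
        using that unfolding monoid_cong_def by (simp add: word_cong.sym)
      from group_cong_swap[OF _ _ in_lists(2,1) this]
      have "([], pos_word v' @ inv_word v) \<in> group_cong S R"
        by simp
      ultimately show ?thesis
        unfolding group_cong_def by (metis word_cong.sym word_cong.trans)
    qed
    then have "(w, []) \<in> group_cong S R \<longleftrightarrow> (v, v') \<in> monoid_cong S R"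
      using group_cong_Nil_imp_cong[OF _ run] unfolding cong_def by (rule iffI[rotated])
    then show "\<phi> (group_cong S R `` {w}) = \<one>\<^bsub>G\<^esub> \<longleftrightarrow>
        right_reverses S R (inv_word v @ pos_word v') []"
      unfolding iso_class_eq_one_iff[OF group iso w] right_reverses_Nil_iff_grid[OF in_lists(1)]
        cong_iff_grid[symmetric] cong_def .
  qed
qed

end
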